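(* Let $n \ge 1$, let $A \in M_n(\mathbb{C})$ and let $D \in M_n(\mathbb{C})$ be a density matrix. Then $$\mathrm{Tr}\,\bigl[D\,|A - \mathrm{Tr}[DA]\, I_n|^4\bigr] \;\le\; \frac{4}{3}\, \min_{\lambda \in \mathbb{C}} \|A - \lambda I_n\|^4 .$$
   Context: $M_n(\mathbb{C})$ is the algebra of $n\times n$ complex matrices, $I_n$ is the identity matrix, $\mathrm{Tr}$ is the usual (unnormalized) trace, and $\|\cdot\|$ is the operator (spectral) norm. A density matrix is a positive semidefinite matrix $D$ with $\mathrm{Tr}\,D = 1$. For $B \in M_n(\mathbb{C})$, $|B| = (B^*B)^{1/2}$. *)

theory Defs
  imports "HOL-Analysis.Analysis"
begin

definition adjoint_mat :: "complex ^ 'n ^ 'm \<Rightarrow> complex ^ 'm ^ 'n" where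
  "adjoint_mat A = map_matrix cnj (transpose A)"

(* The order on complex is the one of HOL-Library.Complex_Order:
   0 \<le> z holds iff z is real and nonnegative. *)
definition psd :: "complex ^ 'n ^ 'n \<Rightarrow> bool" where
  "psd A \<longleftrightarrow> adjoint_mat A = A \<and> (\<forall>x. 0 \<le> (\<Sum>i\<in>UNIV. cnj (x $ i) * (A *v x) $ i))"

definition density_matrix :: "complex ^ 'n ^ 'n \<Rightarrow> bool" where
  "density_matrix D \<longleftrightarrow> psd D \<and> trace D = 1"

(* Meaningful for positive semidefinite A, where the positive semidefinite root
   exists and is unique. *)
definition psd_sqrt :: "complex ^ 'n ^ 'n \<Rightarrow> complex ^ 'n ^ 'n" where
  "psd_sqrt A = (THE P. psd P \<and> P ** P = A)"

definition abs_mat :: "complex ^ 'n ^ 'n \<Rightarrow> complex ^ 'n ^ 'n" where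
  "abs_mat B = psd_sqrt (adjoint_mat B ** B)"

(* The overloaded power operator on vectors and matrices is entrywise,
   hence a separate power for the matrix product. *)
primrec mat_power :: "complex ^ 'n ^ 'n \<Rightarrow> nat \<Rightarrow> complex ^ 'n ^ 'n" where
  "mat_power A 0 = mat 1"
| "mat_power A (Suc k) = A ** mat_power A k"

(* The norm on complex ^ 'n is the Euclidean one, so this is the spectral norm. *)
definition op_norm :: "complex ^ 'n ^ 'n \<Rightarrow> real" where
  "op_norm A = onorm (\<lambda>x. A *v x)"

end

theory Submission
  imports Defs
begin

text \<open>Shifting \<open>A\<close> by the minimiser \<open>l0\<close> does not change the left-hand side, so it suffices to bound
  it by \<open>4/3 M^4\<close> with \<open>M = \<parallel>A\<parallel>\<close>. Let \<open>\<phi> X = Tr (D X)\<close>, \<open>m = \<phi> A\<close>, \<open>B = A - m\<close> and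
  \<open>s = \<phi> (B* B)\<close>, and use the semi-inner product \<open>\<phi> (X* Y)\<close>. Then \<open>B\<close> is orthogonal to \<open>1\<close>, so
  \<open>|m|^2 + s = \<phi> (A* A) \<le> M^2\<close>, and \<open>A* B - s\<close> is orthogonal to \<open>1\<close> with squared length at most
  \<open>M^2 s - s^2\<close>. Since \<open>B* B = s + (A* B - s) - cnj m B\<close>, the fourth moment is at most
  \<open>s^2 + 2 (M^2 s - s^2) + 2 |m|^2 s \<le> 4 M^2 s - 3 s^2 \<le> 4/3 M^4\<close>.\<close>

section \<open>Complex inner product, adjoints, rank-one matrices and traces\<close>

definition cinner :: "complex ^ 'n \<Rightarrow> complex ^ 'n \<Rightarrow> complex" where
  "cinner x y = (\<Sum>i\<in>UNIV. cnj (x $ i) * y $ i)"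

definition outer :: "complex ^ 'm \<Rightarrow> complex ^ 'n \<Rightarrow> complex ^ 'n ^ 'm" where
  "outer u v = (\<chi> i j. u $ i * cnj (v $ j))"

lemma cinner_add_left: "cinner (x + y) z = cinner x z + cinner y z"
  and cinner_add_right: "cinner z (x + y) = cinner z x + cinner z y"
  and cinner_diff_left: "cinner (x - y) z = cinner x z - cinner y z"
  and cinner_diff_right: "cinner z (x - y) = cinner z x - cinner z y"
  and cinner_smult_left: "cinner (c *s x) z = cnj c * cinner x z"
  and cinner_smult_right: "cinner x (c *s z) = c * cinner x z"
  and cinner_cnj: "cnj (cinner x y) = cinner y x"
  by (simp_all add: cinner_def sum.distrib sum_subtractf sum_distrib_left algebra_simps)

lemma cinner_zero [simp]: "cinner 0 x = 0" "cinner x 0 = 0"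
  by (simp_all add: cinner_def)

lemma cinner_axis_left [simp]: "cinner (axis i 1) x = x $ i"
  unfolding cinner_def axis_def
  by (subst sum.remove[of _ i]) (auto intro!: sum.neutral)

lemma cinner_self: "cinner x x = of_real ((norm x)\<^sup>2)"
proof -
  have "cinner x x = of_real (\<Sum>i\<in>UNIV. (norm (x $ i))\<^sup>2)"
    by (simp add: cinner_def complex_norm_square mult.commute del: of_real_power)
  also have "(\<Sum>i\<in>UNIV. (norm (x $ i))\<^sup>2) = (norm x)\<^sup>2"
    by (simp add: norm_vec_def L2_set_def sum_nonneg)
  finally show ?thesis .
qed

lemma cinner_self_eq_0_iff: "cinner x x = 0 \<longleftrightarrow> x = 0"
  by (simp add: cinner_self)

text \<open>Links the form to the real inner product of the type class, for which Cauchy-Schwarz is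
  available.\<close>

lemma Re_cinner: "Re (cinner x y) = x \<bullet> y"
  by (simp add: cinner_def inner_vec_def inner_complex_def)

lemma adjoint_mat_nth [simp]: "adjoint_mat A $ i $ j = cnj (A $ j $ i)"
  by (simp add: adjoint_mat_def transpose_def)

lemma adjoint_mat_add: "adjoint_mat (A + B) = adjoint_mat A + adjoint_mat B"
  and adjoint_mat_diff: "adjoint_mat (A - B) = adjoint_mat A - adjoint_mat B"
  and adjoint_mat_adjoint_mat [simp]: "adjoint_mat (adjoint_mat A) = A"
  and adjoint_mat_mat [simp]: "adjoint_mat (mat c) = mat (cnj c)"
  by (simp_all add: vec_eq_iff mat_def)

lemma adjoint_mat_mult: "adjoint_mat (A ** B) = adjoint_mat B ** adjoint_mat A"
  by (simp add: vec_eq_iff matrix_matrix_mult_def mult.commute)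

lemma cinner_adjoint_right: "cinner x (A *v y) = cinner (adjoint_mat A *v x) y"
proof -
  have "cinner x (A *v y) = (\<Sum>i\<in>UNIV. \<Sum>j\<in>UNIV. cnj (x $ i) * A $ i $ j * y $ j)"
    by (simp add: cinner_def matrix_vector_mult_def sum_distrib_left mult.assoc)
  also have "\<dots> = (\<Sum>j\<in>UNIV. \<Sum>i\<in>UNIV. cnj (x $ i) * A $ i $ j * y $ j)"
    by (rule sum.swap)
  also have "\<dots> = cinner (adjoint_mat A *v x) y"
    by (simp add: cinner_def matrix_vector_mult_def sum_distrib_right sum_distrib_left ac_simps)
  finally show ?thesis .
qed

lemma matrix_vector_mult_axis: "(A *v axis j 1) $ i = (A $ i $ j :: complex)"
  unfolding matrix_vector_mult_def axis_def
  by (simp, subst sum.remove[of _ j]) (auto intro!: sum.neutral)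

lemma matrix_vector_mult_smult: "A *v (c *s x) = c *s (A *v (x :: complex ^ 'n))"
  by (simp add: vec_eq_iff matrix_vector_mult_def sum_distrib_left ac_simps)

lemma mat_mult_vector: "mat c *v (x :: complex ^ 'n) = c *s x"
  unfolding vec_eq_iff matrix_vector_mult_def mat_def
  by (intro allI, simp, subst sum.remove, auto intro!: sum.neutral)

lemma mat_matrix_mult_nth: "(mat c ** A) $ i $ j = c * (A :: complex ^ 'n ^ 'm) $ i $ j"
  unfolding matrix_matrix_mult_def mat_def
  by (simp, subst sum.remove[of _ i], auto intro!: sum.neutral)

lemma matrix_mat_mult_nth: "(A ** mat c) $ i $ j = c * (A :: complex ^ 'n ^ 'm) $ i $ j"
  unfolding matrix_matrix_mult_def mat_def
  by (simp, subst sum.remove[of _ j], auto intro!: sum.neutral)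

lemma mat_mult_commute: "A ** mat c = mat c ** (A :: complex ^ 'n ^ 'm)"
  by (simp add: vec_eq_iff mat_matrix_mult_nth matrix_mat_mult_nth)

lemma trace_mat_mult: "trace (mat c ** A) = c * trace (A :: complex ^ 'n ^ 'n)"
  by (simp add: trace_def mat_matrix_mult_nth sum_distrib_left)

lemma matrix_diff_ldistrib: "A ** (B - C) = A ** B - A ** (C :: complex ^ 'n ^ 'm)"
  and matrix_diff_rdistrib: "(P - Q) ** R = P ** R - Q ** (R :: complex ^ 'k ^ 'l)"
  and matrix_add_rdistrib: "(P + Q) ** R = P ** R + Q ** R"
  by (simp_all add: vec_eq_iff matrix_matrix_mult_def sum_subtractf sum.distrib algebra_simps)

lemma trace_adjoint_mat: "trace (adjoint_mat A) = cnj (trace A)"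
  by (simp add: trace_def)

lemma trace_eq_sum_cinner: "trace A = (\<Sum>i\<in>UNIV. cinner (axis i 1) (A *v axis i 1))"
  by (simp add: trace_def matrix_vector_mult_axis)

lemma outer_mult_vector: "outer u v *v x = cinner v x *s u"
  by (simp add: vec_eq_iff outer_def matrix_vector_mult_def cinner_def sum_distrib_left ac_simps)

lemma trace_outer_mult: "trace (outer u v ** A) = cinner v (A *v u)"
proof -
  have "trace (outer u v ** A) = trace (A ** outer u v)" by (rule trace_mul_sym)
  also have "\<dots> = (\<Sum>i\<in>UNIV. \<Sum>k\<in>UNIV. cnj (v $ i) * (A $ i $ k * u $ k))"
    by (simp add: trace_def matrix_matrix_mult_def outer_def ac_simps)
  also have "\<dots> = cinner v (A *v u)"
    by (simp add: cinner_def matrix_vector_mult_def sum_distrib_left)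
  finally show ?thesis .
qed

section \<open>Positive semidefinite matrices and uniqueness of square roots\<close>

lemma psd_cinner: "psd A \<longleftrightarrow> adjoint_mat A = A \<and> (\<forall>x. 0 \<le> cinner x (A *v x))"
  by (simp add: psd_def cinner_def)

text \<open>Polarization on basis vectors: \<open>e_i + e_j\<close> compares the imaginary parts of
  the entries at \<open>(i, j)\<close> and \<open>(j, i)\<close>, and \<open>e_i + \<i> e_j\<close>
  compares their real parts.\<close>

lemma hermitian_if_real_form:
  assumes "\<And>x. Im (cinner x (A *v x)) = 0"
  shows "adjoint_mat A = A"
proof -
  have e: "Re (A $ i $ j) = Re (A $ j $ i) \<and> Im (A $ i $ j) = - Im (A $ j $ i)" for i j
    using assms[of "axis i 1"] assms[of "axis j 1"]
      assms[of "axis i 1 + axis j 1"] assms[of "axis i 1 + \<i> *s axis j 1"]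
    by (simp add: cinner_add_left cinner_add_right cinner_smult_left
        matrix_vector_mult_smult matrix_vector_right_distrib matrix_vector_mult_axis)
  show ?thesis
  proof (simp only: vec_eq_iff, intro allI)
    fix i j
    show "adjoint_mat A $ i $ j = A $ i $ j"
      using e[of i j] by (simp add: complex_eq_iff)
  qed
qed

lemma psdI:
  assumes "\<And>x. 0 \<le> cinner x (A *v x)"
  shows "psd A"
  using assms hermitian_if_real_form[of A] by (auto simp: psd_cinner less_eq_complex_def)

text \<open>If \<open>y = P x\<close> were nonzero, a small step from \<open>x\<close> in the
  direction \<open>- y\<close> would make the form negative.\<close>

lemma psd_mult_eq_0:
  assumes "psd P" and "cinner x (P *v x) = 0"
  shows "P *v x = 0"
proof -
  define y where "y = P *v x"
  define c where "c = Re (cinner y (P *v y))"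
  define n where "n = (norm y)\<^sup>2"
  \<comment> \<open>This step length turns \<open>- 2 t n + t^2 c\<close> into
    \<open>- t^2 (c + 2)\<close>; the summand 1 keeps the denominator positive when
    \<open>c = 0\<close>.\<close>
  define t where "t = n / (c + 1)"
  have herm: "adjoint_mat P = P" and pos: "\<And>z. 0 \<le> cinner z (P *v z)"
    using assms(1) by (auto simp: psd_cinner)
  have c: "c \<ge> 0" using pos[of y] by (simp add: c_def less_eq_complex_def)
  then have nt: "n = t * (c + 1)" by (simp add: t_def)
  have xy: "cinner x (P *v y) = of_real n"
    by (simp add: cinner_adjoint_right herm y_def[symmetric] n_def cinner_self)
  have yx: "cinner y (P *v x) = of_real n"
    by (simp add: y_def[symmetric] n_def cinner_self)
  have "0 \<le> Re (cinner (x - of_real t *s y) (P *v (x - of_real t *s y)))"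
    using pos by (simp add: less_eq_complex_def)
  also have "\<dots> = - 2 * t * n + t\<^sup>2 * c"
    using assms(2) xy yx
    by (simp add: cinner_diff_left cinner_diff_right cinner_smult_left cinner_smult_right
        matrix_vector_mult_smult matrix_vector_mult_diff_distrib c_def power2_eq_square
        algebra_simps)
  also have "\<dots> = - (t\<^sup>2 * (c + 2))"
    using nt by (simp add: power2_eq_square algebra_simps)
  finally have "t\<^sup>2 \<le> 0" using c by (simp add: mult_le_0_iff)
  then have "n = 0" using nt by simp
  then show ?thesis by (simp add: n_def y_def)
qed

lemma psd_form_nonneg: "psd A \<Longrightarrow> 0 \<le> cinner x (A *v x)"
  by (simp add: psd_cinner)

lemma psd_trace_nonneg: "psd A \<Longrightarrow> 0 \<le> trace A"
  unfolding trace_eq_sum_cinner by (intro sum_nonneg psd_form_nonneg)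

text \<open>A Schur complement step: the form of the reduced matrix at \<open>x\<close> is the form
  of \<open>E\<close> at \<open>x - c v\<close>, where \<open>c\<close> makes this vector
  \<open>E\<close>-orthogonal to \<open>v\<close>.\<close>

lemma psd_rank_one_reduction:
  assumes "psd E" and "cinner v (E *v v) = of_real d" and "d > 0"
  shows "psd (E - mat (of_real (1 / d)) ** outer (E *v v) (E *v v))"
proof (rule psdI)
  fix x
  have herm: "adjoint_mat E = E" and pos: "\<And>z. 0 \<le> cinner z (E *v z)"
    using assms(1) by (auto simp: psd_cinner)
  define b where "b = cinner (E *v v) x"
  define c where "c = b / of_real d"
  have vx: "cinner v (E *v x) = b" by (simp add: b_def cinner_adjoint_right herm)
  have xv: "cinner x (E *v v) = cnj b" by (simp add: b_def cinner_cnj)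
  have "cinner x ((E - mat (of_real (1 / d)) ** outer (E *v v) (E *v v)) *v x)
    = cinner x (E *v x) - cnj b * b / of_real d"
    by (simp add: matrix_vector_mult_diff_rdistrib matrix_vector_mul_assoc[symmetric]
        outer_mult_vector mat_mult_vector cinner_diff_right cinner_smult_right xv b_def[symmetric])
  also have "\<dots> = cinner (x - c *s v) (E *v (x - c *s v))"
    using assms(3)
    by (simp add: cinner_diff_left cinner_diff_right cinner_smult_left cinner_smult_right
        matrix_vector_mult_smult matrix_vector_mult_diff_distrib assms(2) vx xv c_def field_simps)
  finally show "0 \<le> cinner x ((E - mat (of_real (1 / d)) ** outer (E *v v) (E *v v)) *v x)"
    using pos by simp
qed

text \<open>Rank-one pieces \<open>outer u u\<close> are peeled off \<open>E\<close> with positive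
  weights, and each contributes a multiple of the form of \<open>Q\<close> at \<open>u\<close>. The
  induction is on the number of nonzero columns of \<open>E\<close>, so no spectral theorem
  enters.\<close>

lemma trace_psd_mult_psd_nonneg:
  fixes E Q :: "complex ^ 'n ^ 'n"
  assumes "psd E" and Q: "psd Q"
  shows "0 \<le> trace (E ** Q)"
  using assms(1)
proof (induction "card {j. E *v axis j 1 \<noteq> 0}" arbitrary: E rule: less_induct)
  case (less E)
  show ?case
  proof (cases "\<exists>j. E *v axis j 1 \<noteq> 0")
    case False
    then have "E = 0"
      by (metis matrix_vector_mult_axis vec_eq_iff zero_index)
    then show ?thesis by (simp add: trace_def matrix_matrix_mult_def)
  next
    case True
    then obtain j where j: "E *v axis j 1 \<noteq> 0" by blast
    define v :: "complex ^ 'n" where "v = axis j 1"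
    have herm: "adjoint_mat E = E" and pos: "\<And>z. 0 \<le> cinner z (E *v z)"
      using less.prems by (auto simp: psd_cinner)
    define d where "d = Re (cinner v (E *v v))"
    have d: "cinner v (E *v v) = of_real d"
      using pos[of v] by (simp add: d_def less_eq_complex_def complex_eq_iff)
    have "d \<noteq> 0" using psd_mult_eq_0[OF less.prems, of v] d j by (auto simp: v_def)
    moreover have "d \<ge> 0" using pos[of v] by (simp add: d_def less_eq_complex_def)
    ultimately have dpos: "d > 0" by simp
    define F where "F = E - mat (of_real (1 / d)) ** outer (E *v v) (E *v v)"
    have F: "psd F" unfolding F_def by (rule psd_rank_one_reduction[OF less.prems d dpos])
    have Fx: "F *v x = E *v x - (cinner v (E *v x) / of_real d) *s (E *v v)" for x
      by (simp add: F_def matrix_vector_mult_diff_rdistrib matrix_vector_mul_assoc[symmetric]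
          outer_mult_vector mat_mult_vector cinner_adjoint_right herm)
    \<comment> \<open>The reduction kills column \<open>j\<close> and leaves every zero column zero,
      so the induction measure drops.\<close>
    have "F *v v = 0" using dpos by (simp add: Fx d)
    moreover have "F *v x = 0" if "E *v x = 0" for x using that by (simp add: Fx)
    ultimately have "{k. F *v axis k 1 \<noteq> 0} \<subset> {k. E *v axis k 1 \<noteq> 0}"
      using j by (auto simp: v_def)
    then have "card {k. F *v axis k 1 \<noteq> 0} < card {k. E *v axis k 1 \<noteq> 0}"
      by (intro psubset_card_mono) auto
    then have IH: "0 \<le> trace (F ** Q)" using less.hyps F by blast
    have "E = F + mat (of_real (1 / d)) ** outer (E *v v) (E *v v)" by (simp add: F_def)
    then have "trace (E ** Q)
        = trace (F ** Q) + of_real (1 / d) * trace (outer (E *v v) (E *v v) ** Q)"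
      by (metis matrix_add_rdistrib matrix_mul_assoc trace_add trace_mat_mult)
    moreover have "0 \<le> trace (outer (E *v v) (E *v v) ** Q)"
      using Q by (simp add: trace_outer_mult psd_cinner)
    moreover have "0 \<le> complex_of_real (1 / d)" using dpos by (simp add: less_eq_complex_def)
    ultimately show ?thesis
      using IH by (metis add_nonneg_nonneg mult_nonneg_nonneg)
  qed
qed

lemma psd_adjoint_mult_self: "psd (adjoint_mat X ** X)"
  by (rule psdI) (simp add: matrix_vector_mul_assoc[symmetric] cinner_adjoint_right cinner_self
      less_eq_complex_def)

lemma psd_conjugation:
  assumes "psd P"
  shows "psd (adjoint_mat X ** P ** X)"
  using assms by (intro psdI)
    (simp add: matrix_vector_mul_assoc[symmetric] cinner_adjoint_right[of _ "adjoint_mat X"] psd_cinner)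

text \<open>The trace is the sum of the nonnegative values of the form of \<open>P\<close> at the
  columns of \<open>X\<close>; all of them vanish, so \<open>P\<close> kills each column.\<close>

lemma psd_trace_conjugation_eq_0:
  assumes P: "psd P" and tr: "trace (adjoint_mat X ** P ** X) = 0"
  shows "P ** X = 0"
proof -
  let ?q = "\<lambda>j. cinner (axis j 1) ((adjoint_mat X ** P ** X) *v axis j 1)"
  have q: "0 \<le> ?q j" for j
    by (intro psd_form_nonneg psd_conjugation P)
  have "(\<Sum>j\<in>UNIV. ?q j) = 0" using tr by (simp only: trace_eq_sum_cinner)
  then have "?q j = 0" for j
    using q by (subst (asm) sum_nonneg_eq_0_iff) auto
  then have "cinner (X *v axis j 1) (P *v (X *v axis j 1)) = 0" for j
    by (simp only: matrix_vector_mul_assoc[symmetric] cinner_adjoint_right[of _ "adjoint_mat X"]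
        adjoint_mat_adjoint_mat)
  then have "P *v (X *v axis j 1) = 0" for j by (intro psd_mult_eq_0 P)
  then have "(P ** X) *v axis j 1 = 0" for j by (simp add: matrix_vector_mul_assoc)
  then show ?thesis by (metis matrix_vector_mult_axis vec_eq_iff zero_index)
qed

lemma adjoint_mult_self_eq_0:
  assumes "adjoint_mat X ** X = 0"
  shows "X = 0"
proof -
  have "cinner (X *v x) (X *v x) = 0" for x
    by (simp add: cinner_adjoint_right matrix_vector_mul_assoc assms)
  then have "X *v x = 0" for x by (simp add: cinner_self_eq_0_iff)
  then show ?thesis by (metis matrix_vector_mult_axis vec_eq_iff zero_index)
qed

text \<open>With \<open>X = P - Q\<close>, equality of the squares gives
  \<open>P X + X Q = 0\<close>. Multiplying by \<open>X\<close> and taking traces yields two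
  nonnegative numbers with sum zero.\<close>

lemma psd_square_root_unique:
  assumes P: "psd P" and Q: "psd Q" and eq: "P ** P = Q ** Q"
  shows "P = Q"
proof -
  define X where "X = P - Q"
  have hP: "adjoint_mat P = P" and hQ: "adjoint_mat Q = Q"
    using P Q by (auto simp: psd_cinner)
  have hX: "adjoint_mat X = X" by (simp add: X_def adjoint_mat_diff hP hQ)
  have "P ** X + X ** Q = 0"
    by (simp add: X_def matrix_diff_ldistrib matrix_diff_rdistrib eq)
  then have "X ** (P ** X + X ** Q) = 0" by (simp add: matrix_matrix_mult_def vec_eq_iff)
  then have "X ** P ** X + X ** (X ** Q) = 0"
    by (simp add: matrix_add_ldistrib matrix_mul_assoc)
  then have "trace (X ** P ** X) + trace (X ** (X ** Q)) = 0"
    by (metis trace_add mat_0 trace_0)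
  moreover have "trace (X ** (X ** Q)) = trace (X ** Q ** X)"
    by (rule trace_mul_sym)
  ultimately have sum0: "trace (adjoint_mat X ** P ** X) + trace (adjoint_mat X ** Q ** X) = 0"
    by (simp add: hX)
  have nn: "0 \<le> trace (adjoint_mat X ** R ** X)" if "psd R" for R
    by (intro psd_trace_nonneg psd_conjugation that)
  have "trace (adjoint_mat X ** P ** X) = 0" "trace (adjoint_mat X ** Q ** X) = 0"
    using sum0 nn[OF P] nn[OF Q] by (simp_all add: add_nonneg_eq_0_iff)
  then have "P ** X = 0" "Q ** X = 0"
    using psd_trace_conjugation_eq_0 P Q by blast+
  \<comment> \<open>Since \<open>X\<close> is self-adjoint, the product is
    \<open>X X = P X - Q X\<close>.\<close>
  then have "adjoint_mat X ** X = 0"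
    by (simp add: hX) (simp add: X_def matrix_diff_rdistrib)
  then have "X = 0" by (rule adjoint_mult_self_eq_0)
  then show ?thesis by (simp add: X_def)
qed

section \<open>Polar decomposition and the absolute value\<close>

lemma compact_isometries: "compact {W :: complex ^ 'n ^ 'n. adjoint_mat W ** W = mat 1}"
proof -
  let ?U = "{W :: complex ^ 'n ^ 'n. adjoint_mat W ** W = mat 1}"
  have "?U = {W. \<forall>i j. (\<Sum>k\<in>UNIV. cnj (W $ k $ i) * W $ k $ j) = mat 1 $ i $ j}"
    by (simp add: vec_eq_iff matrix_matrix_mult_def)
  also have "closed \<dots>"
    by (intro closed_Collect_all closed_Collect_eq continuous_intros)
  finally have cl: "closed ?U" .
  have "norm W \<le> sqrt (real CARD('n))" if W: "adjoint_mat W ** W = mat 1" for W :: "complex ^ 'n ^ 'n"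
  proof -
    \<comment> \<open>The type class norm of a matrix is the Frobenius norm, whose square is
      \<open>trace (adjoint_mat W ** W)\<close>, here the dimension.\<close>
    have "complex_of_real ((norm W)\<^sup>2) = (\<Sum>i\<in>UNIV. cinner (W $ i) (W $ i))"
      by (simp add: cinner_self norm_vec_def[of W] L2_set_def sum_nonneg del: of_real_power)
    also have "\<dots> = trace (adjoint_mat W ** W)"
      unfolding cinner_def trace_def matrix_matrix_mult_def
      by (simp, rule sum.swap)
    also have "\<dots> = complex_of_real (real CARD('n))" by (simp add: W trace_I)
    finally have "(norm W)\<^sup>2 = real CARD('n)" by (simp only: of_real_eq_iff)
    then show ?thesis by (simp add: real_le_rsqrt)
  qed
  then have "bounded ?U" by (intro boundedI) blast
  then show ?thesis using cl by (simp add: compact_eq_bounded_closed)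
qed

text \<open>\<open>U\<close> multiplies \<open>v\<close> by the unimodular \<open>z\<close> and
  fixes the orthogonal complement of \<open>v\<close>.\<close>

lemma isometry_rank_one_perturbation:
  assumes "cinner v v = 1" and "norm z = 1"
  defines "U \<equiv> mat 1 + outer ((z - 1) *s v) v"
  shows "adjoint_mat U ** U = mat 1"
proof -
  define c where "c = z - 1"
  have "cnj z * z = 1" using assms(2) by (metis complex_norm_square mult.commute of_real_1 one_power2)
  \<comment> \<open>This is \<open>|1 + c|^2 = 1\<close>; it is the total coefficient of
    \<open>outer v v\<close> in the expansion of \<open>adjoint_mat U ** U\<close>.\<close>
  then have c: "cnj c + c + cnj c * c = 0" by (simp add: c_def algebra_simps)
  have adj: "adjoint_mat (outer (c *s v) v) = outer (cnj c *s v) v"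
    by (simp add: vec_eq_iff outer_def ac_simps)
  have sq: "outer (cnj c *s v) v ** outer (c *s v) v = outer ((cnj c * c) *s v) v"
  proof -
    have "(outer (cnj c *s v) v ** outer (c *s v) v) $ i $ j
        = cnj c * c * v $ i * cnj (v $ j) * cinner v v" for i j
      by (simp add: matrix_matrix_mult_def outer_def cinner_def sum_distrib_left ac_simps)
    then show ?thesis by (simp add: vec_eq_iff outer_def assms(1))
  qed
  have sum: "outer (cnj c *s v) v + outer (c *s v) v + outer ((cnj c * c) *s v) v = 0"
  proof -
    have "(outer (cnj c *s v) v + outer (c *s v) v + outer ((cnj c * c) *s v) v) $ i $ j
        = (cnj c + c + cnj c * c) * v $ i * cnj (v $ j)" for i j
      by (simp add: outer_def algebra_simps)
    then show ?thesis by (simp add: vec_eq_iff c)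
  qed
  have "adjoint_mat U ** U
      = mat 1 + (outer (cnj c *s v) v + outer (c *s v) v + outer ((cnj c * c) *s v) v)"
    by (simp add: U_def c_def[symmetric] adjoint_mat_add adj matrix_add_ldistrib
        matrix_add_rdistrib sq)
  then show ?thesis by (simp add: sum)
qed

text \<open>A matrix \<open>W\<close> maximising \<open>Re Tr (W B)\<close> over the unitary group turns \<open>B\<close> into a positive
  semidefinite \<open>W B\<close>: rotating \<open>W\<close> along a unit vector \<open>v\<close> shows \<open>Re (z q) \<le> Re q\<close> for all
  unimodular \<open>z\<close>, where \<open>q\<close> is the value of the quadratic form of \<open>W B\<close> at \<open>v\<close>.\<close>

lemma polar_decomposition:
  fixes B :: "complex ^ 'n ^ 'n"
  obtains W where "adjoint_mat W ** W = mat 1" and "psd (W ** B)"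
proof -
  let ?U = "{W :: complex ^ 'n ^ 'n. adjoint_mat W ** W = mat 1}"
  have "mat 1 \<in> ?U" by simp
  then have "?U \<noteq> {}" by blast
  moreover have "continuous_on ?U (\<lambda>W. Re (trace (W ** B)))"
    unfolding trace_def matrix_matrix_mult_def by (simp, intro continuous_intros)
  ultimately obtain W where W: "adjoint_mat W ** W = mat 1"
    and max: "\<And>V. adjoint_mat V ** V = mat 1 \<Longrightarrow> Re (trace (V ** B)) \<le> Re (trace (W ** B))"
    using continuous_attains_sup[OF compact_isometries, of "\<lambda>W. Re (trace (W ** B))"] by blast
  have unit: "0 \<le> cinner v ((W ** B) *v v)" if v: "cinner v v = 1" for v
  proof -
    define q where "q = cinner v ((W ** B) *v v)"
    have le: "Re (z * q) \<le> Re q" if z: "norm z = 1" for z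
    proof -
      define U where "U = mat 1 + outer ((z - 1) *s v) v"
      have U: "adjoint_mat U ** U = mat 1"
        unfolding U_def by (rule isometry_rank_one_perturbation[OF v z])
      have "adjoint_mat (U ** W) ** (U ** W) = adjoint_mat W ** (adjoint_mat U ** U) ** W"
        by (simp add: adjoint_mat_mult matrix_mul_assoc)
      then have "adjoint_mat (U ** W) ** (U ** W) = mat 1" by (simp add: U W)
      then have "Re (trace (U ** W ** B)) \<le> Re (trace (W ** B))" by (rule max)
      moreover have "trace (U ** W ** B) = trace (W ** B) + (z - 1) * q"
        by (simp add: U_def matrix_add_rdistrib trace_add trace_outer_mult
            matrix_mul_assoc[symmetric] matrix_vector_mult_smult cinner_smult_right q_def
            del: vector_sub_rdistrib)
      ultimately show ?thesis by (simp add: algebra_simps)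
    qed
    have "norm q \<le> Re q"
    proof (cases "q = 0")
      case False
      \<comment> \<open>This \<open>z\<close> rotates \<open>q\<close> onto \<open>|q|\<close>, so
        maximality gives \<open>|q| \<le> Re q\<close>, which forces \<open>q\<close> to be real and
        nonnegative.\<close>
      have "norm (cnj q / norm q) = 1" using False by (simp add: norm_divide)
      moreover have "cnj q / norm q * q = of_real (norm q)"
        using False by (simp add: mult.commute complex_norm_square[symmetric] power2_eq_square)
      ultimately show ?thesis using le[of "cnj q / norm q"] by simp
    qed simp
    then have "(norm q)\<^sup>2 \<le> (Re q)\<^sup>2" "0 \<le> Re q"
      using norm_ge_zero[of q] by (simp_all only: power_mono order_trans)
    then have "Im q = 0" "0 \<le> Re q" by (simp_all add: cmod_power2)
    then show ?thesis by (simp add: q_def[symmetric] less_eq_complex_def)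
  qed
  have "psd (W ** B)"
  proof (rule psdI)
    fix x
    show "0 \<le> cinner x ((W ** B) *v x)"
    proof (cases "x = 0")
      case False
      define r where "r = complex_of_real (norm x)"
      define v where "v = (1 / r) *s x"
      have r: "r \<noteq> 0" "cnj r = r" using False by (auto simp: r_def)
      have x: "x = r *s v" using r by (simp add: v_def vector_smult_assoc)
      have "cinner v v = cnj (1 / r) * (1 / r * cinner x x)"
        by (simp only: v_def cinner_smult_left cinner_smult_right mult.left_commute)
      also have "cinner x x = r * r" by (simp add: cinner_self r_def power2_eq_square)
      finally have "cinner v v = 1" using r by simp
      then have q: "0 \<le> cinner v ((W ** B) *v v)" by (rule unit)
      have "cinner x ((W ** B) *v x) = r * r * cinner v ((W ** B) *v v)"
        by (simp add: x cinner_smult_left cinner_smult_right matrix_vector_mult_smult r)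
      moreover have "0 \<le> r * r" by (simp add: r_def less_eq_complex_def)
      ultimately show ?thesis using q by simp
    qed simp
  qed
  then show thesis using W that by blast
qed

text \<open>The definite description in \<open>psd_sqrt\<close> needs both existence and uniqueness
  of the root. Existence comes from the polar decomposition: \<open>W ** B\<close> is self-adjoint
  and \<open>W\<close> cancels in its square.\<close>

lemma abs_mat_square: "abs_mat B ** abs_mat B = adjoint_mat B ** B"
proof -
  obtain W where W: "adjoint_mat W ** W = mat 1" and psd: "psd (W ** B)"
    by (rule polar_decomposition)
  have "(W ** B) ** (W ** B) = adjoint_mat (W ** B) ** (W ** B)"
    using psd by (simp add: psd_cinner)
  also have "\<dots> = adjoint_mat B ** (adjoint_mat W ** W) ** B"
    by (simp add: adjoint_mat_mult matrix_mul_assoc)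
  finally have root: "(W ** B) ** (W ** B) = adjoint_mat B ** B" by (simp add: W)
  have "abs_mat B = W ** B"
    unfolding abs_mat_def psd_sqrt_def
    using psd root by (intro the_equality) (auto intro: psd_square_root_unique)
  then show ?thesis by (simp add: root)
qed

lemma mat_power_abs_mat_4:
  "mat_power (abs_mat B) 4 = (adjoint_mat B ** B) ** (adjoint_mat B ** B)"
  by (simp add: numeral_eq_Suc matrix_mul_assoc) (metis abs_mat_square matrix_mul_assoc)

section \<open>Operator norm and distance to the scalar matrices\<close>

lemma norm_mult_vector_le_op_norm: "norm (A *v x) \<le> op_norm A * norm x"
  unfolding op_norm_def by (rule onorm) simp

lemma op_norm_nonneg: "0 \<le> op_norm A"
  unfolding op_norm_def by (rule onorm_pos_le) simp

lemma op_normI: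
  assumes "\<And>x. norm (A *v x) \<le> b * norm x"
  shows "op_norm A \<le> b"
  unfolding op_norm_def using assms by (rule onorm_le)

text \<open>For \<open>y = A* x\<close>, the square of \<open>norm y\<close> is the inner product of
  \<open>x\<close> with \<open>A y\<close>; Cauchy-Schwarz then allows one factor
  \<open>norm y\<close> to be cancelled.\<close>

lemma norm_adjoint_mult_vector_le: "norm (adjoint_mat A *v x) \<le> op_norm A * norm x"
proof -
  define y where "y = adjoint_mat A *v x"
  have "(norm y)\<^sup>2 = Re (cinner y y)" by (simp add: cinner_self)
  also have "cinner y y = cinner x (A *v y)" by (simp add: cinner_adjoint_right y_def)
  also have "Re \<dots> \<le> norm x * norm (A *v y)"
    by (simp add: Re_cinner norm_cauchy_schwarz)
  also have "\<dots> \<le> norm x * (op_norm A * norm y)"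
    by (intro mult_left_mono norm_mult_vector_le_op_norm) simp
  finally have "norm y * norm y \<le> (op_norm A * norm x) * norm y"
    by (simp add: power2_eq_square ac_simps)
  then have "norm y \<le> op_norm A * norm x"
    by (cases "y = 0") (simp_all add: op_norm_nonneg)
  then show ?thesis by (simp add: y_def)
qed

text \<open>Turns a bound on vectors into an operator inequality that can be traced against a
  density matrix.\<close>

lemma psd_norm_bound:
  assumes "\<And>x. norm (X *v x) \<le> c * norm x"
  shows "psd (mat (of_real (c\<^sup>2)) - adjoint_mat X ** X)"
proof (rule psdI)
  fix x
  have "(norm (X *v x))\<^sup>2 \<le> (c * norm x)\<^sup>2" using assms by (intro power_mono) auto
  moreover have "cinner x ((mat (of_real (c\<^sup>2)) - adjoint_mat X ** X) *v x)
      = of_real ((c * norm x)\<^sup>2 - (norm (X *v x))\<^sup>2)"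
    by (simp add: matrix_vector_mult_diff_rdistrib cinner_diff_right mat_mult_vector
        cinner_smult_right matrix_vector_mul_assoc[symmetric]
        cinner_adjoint_right[of _ "adjoint_mat X"] cinner_self power_mult_distrib)
  ultimately show "0 \<le> cinner x ((mat (of_real (c\<^sup>2)) - adjoint_mat X ** X) *v x)"
    by (simp only: less_eq_complex_def) simp
qed

lemma norm_smult_vector: "norm (c *s (x :: complex ^ 'n)) = norm c * norm x"
proof -
  have "complex_of_real ((norm (c *s x))\<^sup>2) = of_real ((norm c * norm x)\<^sup>2)"
    by (simp only: cinner_self[symmetric] cinner_smult_left cinner_smult_right power_mult_distrib
        of_real_mult complex_norm_square) simp
  then have "(norm (c *s x))\<^sup>2 = (norm c * norm x)\<^sup>2" by (simp only: of_real_eq_iff)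
  then show ?thesis by (simp add: power2_eq_iff_nonneg)
qed

lemma op_norm_diff_mat_le: "op_norm (A - mat l) \<le> op_norm (A - mat k) + norm (k - l)"
proof (rule op_normI)
  fix x
  have "(A - mat l) *v x = (A - mat k) *v x + (k - l) *s x"
    by (simp add: matrix_vector_mult_diff_rdistrib mat_mult_vector vector_sub_rdistrib)
  then have "norm ((A - mat l) *v x) \<le> norm ((A - mat k) *v x) + norm ((k - l) *s x)"
    by (simp add: norm_triangle_ineq)
  also have "\<dots> \<le> op_norm (A - mat k) * norm x + norm (k - l) * norm x"
    by (intro add_mono norm_mult_vector_le_op_norm) (simp add: norm_smult_vector del: vector_sub_rdistrib)
  finally show "norm ((A - mat l) *v x) \<le> (op_norm (A - mat k) + norm (k - l)) * norm x"
    by (simp add: algebra_simps)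
qed

lemma norm_le_op_norm_diff_mat:
  fixes A :: "complex ^ 'n ^ 'n"
  shows "norm l \<le> op_norm (A - mat l) + op_norm A"
proof -
  \<comment> \<open>Any unit vector serves; \<open>undefined\<close> merely names some
    index.\<close>
  define x :: "complex ^ 'n" where "x = axis undefined 1"
  have x: "norm x = 1" by (simp add: x_def)
  have "l *s x = A *v x - (A - mat l) *v x"
    by (simp add: matrix_vector_mult_diff_rdistrib mat_mult_vector)
  then have "norm (l *s x) \<le> norm (A *v x) + norm ((A - mat l) *v x)"
    by (simp add: norm_triangle_ineq4)
  then show ?thesis
    using norm_mult_vector_le_op_norm[of A x] norm_mult_vector_le_op_norm[of "A - mat l" x]
    by (simp add: norm_smult_vector x)
qed

text \<open>The function is 1-Lipschitz, so it has a minimum on a compact disc, and outside a large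
  enough disc it exceeds its value at 0.\<close>

lemma op_norm_diff_mat_attains_min: "\<exists>l0. \<forall>l. op_norm (A - mat l0) \<le> op_norm (A - mat l)"
proof -
  let ?f = "\<lambda>l. op_norm (A - mat l)"
  \<comment> \<open>Beyond this radius \<open>norm_le_op_norm_diff_mat\<close> gives a value above
    \<open>op_norm A\<close>, which is the value at \<open>l = 0\<close>.\<close>
  let ?K = "cball (0 :: complex) (2 * op_norm A)"
  have "dist (?f l) (?f k) \<le> dist l k" for l k
    using op_norm_diff_mat_le[of A l k] op_norm_diff_mat_le[of A k l]
    by (simp add: dist_norm norm_minus_commute abs_le_iff)
  then have "continuous_on ?K ?f"
    unfolding continuous_on_iff by (metis le_less_trans)
  then obtain l0 where l0: "\<And>l. l \<in> ?K \<Longrightarrow> ?f l0 \<le> ?f l"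
    using continuous_attains_inf[of ?K ?f] op_norm_nonneg[of A] by fastforce
  have "?f l0 \<le> ?f l" for l
  proof (cases "l \<in> ?K")
    case False
    have "?f l0 \<le> ?f 0" using op_norm_nonneg[of A] by (intro l0) simp
    also have "\<dots> \<le> ?f l" using False norm_le_op_norm_diff_mat[of l A] by simp
    finally show ?thesis .
  qed (rule l0)
  then show ?thesis by blast
qed

section \<open>The semi-inner product (GNS form) induced by a density matrix\<close>

definition gram :: "complex ^ 'n ^ 'n \<Rightarrow> complex ^ 'n ^ 'n \<Rightarrow> complex ^ 'n ^ 'n \<Rightarrow> complex" where
  "gram D X Y = trace (D ** (adjoint_mat X ** Y))"

lemma gram_add_left: "gram D (X + Y) Z = gram D X Z + gram D Y Z"
  and gram_add_right: "gram D Z (X + Y) = gram D Z X + gram D Z Y"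
  and gram_diff_left: "gram D (X - Y) Z = gram D X Z - gram D Y Z"
  and gram_diff_right: "gram D Z (X - Y) = gram D Z X - gram D Z Y"
  by (simp_all add: gram_def adjoint_mat_add adjoint_mat_diff matrix_add_ldistrib
      matrix_add_rdistrib matrix_diff_ldistrib matrix_diff_rdistrib trace_add trace_sub)

lemma gram_mat_mult_left: "gram D (mat c ** X) Z = cnj c * gram D X Z"
  and gram_mat_mult_right: "gram D X (mat c ** Z) = c * gram D X Z"
proof -
  show "gram D (mat c ** X) Z = cnj c * gram D X Z"
    by (simp add: gram_def adjoint_mat_mult mat_mult_commute)
      (metis mat_mult_commute matrix_mul_assoc trace_mat_mult)
  show "gram D X (mat c ** Z) = c * gram D X Z"
    unfolding gram_def by (metis mat_mult_commute matrix_mul_assoc trace_mat_mult)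
qed

lemma gram_commute:
  assumes "psd D"
  shows "gram D Y X = cnj (gram D X Y)"
proof -
  have "cnj (gram D X Y) = trace (adjoint_mat (D ** (adjoint_mat X ** Y)))"
    by (simp add: gram_def trace_adjoint_mat)
  also have "\<dots> = trace ((adjoint_mat Y ** X) ** D)"
    using assms by (simp add: adjoint_mat_mult psd_cinner)
  also have "\<dots> = gram D Y X" unfolding gram_def by (rule trace_mul_sym)
  finally show ?thesis by simp
qed

lemma gram_self_nonneg: "psd D \<Longrightarrow> 0 \<le> gram D X X"
  unfolding gram_def by (intro trace_psd_mult_psd_nonneg psd_adjoint_mult_self)

text \<open>The matrix \<open>X* (c^2 - C* C) X\<close> is positive semidefinite, so its trace
  against \<open>D\<close> is nonnegative.\<close>

lemma gram_mult_le:
  assumes "psd D" and "\<And>x. norm (C *v x) \<le> c * norm x"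
  shows "Re (gram D (C ** X) (C ** X)) \<le> c\<^sup>2 * Re (gram D X X)"
proof -
  have "0 \<le> trace (D ** (adjoint_mat X ** (mat (of_real (c\<^sup>2)) - adjoint_mat C ** C) ** X))"
    by (intro trace_psd_mult_psd_nonneg psd_conjugation psd_norm_bound assms)
  also have "adjoint_mat X ** (mat (of_real (c\<^sup>2)) - adjoint_mat C ** C) ** X
      = adjoint_mat X ** (mat (of_real (c\<^sup>2)) ** X) - adjoint_mat (C ** X) ** (C ** X)"
    by (simp add: matrix_diff_ldistrib matrix_diff_rdistrib adjoint_mat_mult matrix_mul_assoc)
  also have "trace (D ** \<dots>) = of_real (c\<^sup>2) * gram D X X - gram D (C ** X) (C ** X)"
    by (simp only: gram_mat_mult_right[symmetric])
      (simp add: gram_def matrix_diff_ldistrib trace_sub)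
  finally show ?thesis by (simp add: less_eq_complex_def del: of_real_power)
qed

section \<open>Bound on the fourth central moment\<close>

lemma fourth_central_moment_le:
  fixes A D :: "complex ^ 'n ^ 'n"
  assumes "density_matrix D"
  defines "B \<equiv> A - mat (trace (D ** A))"
  shows "trace (D ** ((adjoint_mat B ** B) ** (adjoint_mat B ** B)))
    \<le> complex_of_real (4 / 3 * op_norm A ^ 4)"
proof -
  have D: "psd D" and tr: "trace D = 1" using assms(1) by (auto simp: density_matrix_def)
  define m where "m = trace (D ** A)"
  define s where "s = Re (gram D B B)"
  \<comment> \<open>Scalars are written \<open>mat c ** I\<close>, so that the scaling rules for
    \<open>gram\<close> apply to them.\<close>
  define I :: "complex ^ 'n ^ 'n" where "I = mat 1"
  define T where "T = adjoint_mat A ** B"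
  define N where "N = adjoint_mat B ** B"
  define M where "M = op_norm A"
  note gram_simps = gram_add_left gram_add_right gram_diff_left gram_diff_right
    gram_mat_mult_left gram_mat_mult_right
  have B: "B = A - mat m ** I" by (simp add: B_def m_def I_def)
  then have A: "A = B + mat m ** I" by simp
  have II: "gram D I I = 1" by (simp add: gram_def I_def tr)
  have IA: "gram D I A = m" by (simp add: gram_def I_def m_def)
  have IB: "gram D I B = 0" by (simp add: B gram_simps II IA)
  have BI: "gram D B I = 0" using gram_commute[OF D, of B I] IB by simp
  have BB: "gram D B B = of_real s" and s: "s \<ge> 0"
    using gram_self_nonneg[OF D, of B] by (auto simp: s_def less_eq_complex_def complex_eq_iff)
  have AA: "gram D A A = of_real s + m * cnj m"
    by (simp add: A gram_simps BB BI IB II)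
  have IT: "gram D I T = of_real s"
  proof -
    have "gram D I T = gram D A B" by (simp add: gram_def I_def T_def)
    then show ?thesis by (simp add: A gram_simps BB IB)
  qed
  have TI: "gram D T I = of_real s" using gram_commute[OF D, of T I] IT by simp
  have N: "N = T - mat (cnj m) ** B"
    unfolding N_def T_def A I_def
    by (simp add: adjoint_mat_add matrix_add_rdistrib)
  have BT: "gram D B T = cnj (gram D T B)" by (rule gram_commute[OF D])
  \<comment> \<open>By orthogonality of \<open>B\<close> and \<open>I\<close> the left side is
    \<open>gram D A A\<close>; the bound is \<open>gram_mult_le\<close> applied to
    \<open>A ** I\<close>.\<close>
  have m_s: "(norm m)\<^sup>2 + s \<le> M\<^sup>2"
  proof -
    have "Re (gram D (A ** I) (A ** I)) \<le> M\<^sup>2 * Re (gram D I I)"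
      unfolding M_def by (intro gram_mult_le D norm_mult_vector_le_op_norm)
    then show ?thesis
      by (simp add: I_def[symmetric] II) (simp add: I_def AA complex_norm_square[symmetric])
  qed
  have TT: "Re (gram D T T) \<le> M\<^sup>2 * s"
    unfolding T_def s_def M_def
    by (intro gram_mult_le D norm_adjoint_mult_vector_le)
  have mm: "(norm m)\<^sup>2 = Re m * Re m + Im m * Im m"
    by (simp add: cmod_power2 flip: power2_eq_square)
  have NN: "Re (gram D N N) = Re (gram D T T) + (norm m)\<^sup>2 * s - 2 * Re (cnj m * gram D T B)"
    unfolding mm by (simp add: N gram_simps BB BT algebra_simps)
  \<comment> \<open>\<open>N = s + (T - s) - cnj m B\<close> and
    \<open>Z = (T - s) + cnj m B\<close>. The parallelogram law for \<open>T - s\<close> and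
    \<open>cnj m B\<close> cancels their cross terms in the sum of the squared lengths of
    \<open>N\<close> and \<open>Z\<close>; that of \<open>Z\<close> is then dropped as
    nonnegative.\<close>
  define Z where "Z = T - mat (of_real s) ** I + mat (cnj m) ** B"
  have "Re (gram D Z Z)
      = Re (gram D T T) - s\<^sup>2 + (norm m)\<^sup>2 * s + 2 * Re (cnj m * gram D T B)"
    unfolding mm
    by (simp add: Z_def gram_simps BB BT TI IT II IB BI power2_eq_square algebra_simps)
  moreover have "0 \<le> Re (gram D Z Z)"
    using gram_self_nonneg[OF D] by (simp add: less_eq_complex_def)
  ultimately have "Re (gram D N N) \<le> 2 * Re (gram D T T) - s\<^sup>2 + 2 * ((norm m)\<^sup>2 * s)"
    using NN by linarith
  also have "\<dots> \<le> 2 * (M\<^sup>2 * s) - s\<^sup>2 + 2 * ((M\<^sup>2 - s) * s)"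
    using TT m_s s by (intro add_mono diff_mono mult_left_mono mult_right_mono) auto
  \<comment> \<open>Completing the square in \<open>s\<close>: the maximum of
    \<open>4 M^2 s - 3 s^2\<close>, at \<open>s = 2/3 M^2\<close>, is the source of the constant
    4/3.\<close>
  also have "\<dots> = 4 / 3 * M ^ 4 - 3 * (s - 2 / 3 * M\<^sup>2)\<^sup>2"
    by (simp add: power2_eq_square power4_eq_xxxx algebra_simps)
  also have "\<dots> \<le> 4 / 3 * M ^ 4" by simp
  finally have "Re (gram D N N) \<le> 4 / 3 * M ^ 4" .
  \<comment> \<open>The order on \<open>complex\<close> compares only numbers with equal imaginary
    parts.\<close>
  moreover have "Im (gram D N N) = 0"
    using gram_self_nonneg[OF D, of N] by (simp add: less_eq_complex_def)
  moreover have "gram D N N = trace (D ** (N ** N))"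
    by (simp add: gram_def N_def adjoint_mat_mult)
  ultimately show ?thesis by (simp add: less_eq_complex_def N_def M_def)
qed

text \<open>Phrasing the bound at a minimiser \<open>l0\<close> makes attainment of the minimum part
  of the claim.\<close>

theorem theorem3:
  fixes A D :: "complex ^ 'n ^ 'n"
  assumes "density_matrix D"
  shows "\<exists>l0. is_arg_min (\<lambda>l. op_norm (A - mat l) ^ 4) (\<lambda>_. True) l0 \<and>
    trace (D ** mat_power (abs_mat (A - mat (trace (D ** A)))) 4)
      \<le> complex_of_real (4 / 3 * op_norm (A - mat l0) ^ 4)"
proof -
  obtain l0 where l0: "\<And>l. op_norm (A - mat l0) \<le> op_norm (A - mat l)"
    using op_norm_diff_mat_attains_min by blast
  have "is_arg_min (\<lambda>l. op_norm (A - mat l) ^ 4) (\<lambda>_. True) l0"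
    by (simp add: is_arg_min_linorder power_mono l0 op_norm_nonneg)
  \<comment> \<open>As \<open>D\<close> has trace 1, subtracting \<open>l0\<close> from
    \<open>A\<close> lowers the mean by exactly \<open>l0\<close>, so the centred matrix is
    unchanged.\<close>
  moreover have shift: "A - mat l0 - mat (trace (D ** (A - mat l0))) = A - mat (trace (D ** A))"
  proof -
    have "trace (D ** mat l0) = l0"
      using assms by (simp add: mat_mult_commute trace_mat_mult density_matrix_def)
    then have "trace (D ** (A - mat l0)) = trace (D ** A) - l0"
      by (simp add: matrix_diff_ldistrib trace_sub)
    then show ?thesis by (simp add: vec_eq_iff mat_def)
  qed
  ultimately show ?thesis
    using fourth_central_moment_le[OF assms, of "A - mat l0"]
    by (auto simp only: mat_power_abs_mat_4 shift)
qed

end
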